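(* The 3-parametric Mittag-Leffler (Prabhakar) function $$E_{\alpha,\beta}^{\gamma}(z) = \sum_{k=0}^{\infty} \frac{(\gamma)_k\, z^k}{k!\, \Gamma(\alpha k + \beta)} = \sum_{k=0}^{\infty} \frac{\Gamma(\gamma+k)\, z^k}{\Gamma(\gamma)\,k!\, \Gamma(\alpha k + \beta)},\qquad z\in\mathbb{C},$$ is differentiable with respect to the parameters $\alpha,\beta,\gamma$ for all $\alpha\in\mathbb{C}$ with $\mathrm{Re}\,\alpha>0$ and all $\beta,\gamma\in\mathbb{C}$ with $\gamma\neq -1,-2,-3,\ldots$, and the following formulas are satisfied: $$\frac{\partial E_{\alpha,\beta}^{\gamma}(z)}{\partial \alpha} = - \sum_{k=1}^{\infty} \frac{k\, \psi(\alpha k + \beta)\, \Gamma(\gamma + k)}{k!\, \Gamma(\gamma)\, \Gamma(\alpha k + \beta)}\, z^k,$$ $$\frac{\partial E_{\alpha,\beta}^{\gamma}(z)}{\partial \beta} = - \sum_{k=0}^{\infty} \frac{\psi(\alpha k + \beta)\, \Gamma(\gamma + k)}{k!\, \Gamma(\gamma)\, \Gamma(\alpha k + \beta)}\, z^k,$$ $$\frac{\partial E_{\alpha,\beta}^{\gamma}(z)}{\partial \gamma} = \sum_{k=0}^{\infty} \frac{\psi(\gamma + k)\, \Gamma(\gamma + k)}{k!\, \Gamma(\gamma)\, \Gamma(\alpha k + \beta)}\, z^k - \psi(\gamma) \sum_{k=0}^{\infty} \frac{\Gamma(\gamma + k)\, z^k}{\Gamma(\gamma)\, k!\, \Gamma(\alpha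 k + \beta)} .$$
   Context: $\Gamma$ is the Gamma function and $\psi=\Gamma'/\Gamma$ is the digamma function. $(\gamma)_k=\gamma(\gamma+1)\cdots(\gamma+k-1)$, $(\gamma)_0=1$, is the Pochhammer symbol, and $\Gamma(\gamma+k)/\Gamma(\gamma)$ means $(\gamma)_k$. $1/\Gamma(w)$ and $\psi(w)/\Gamma(w)=-(1/\Gamma)'(w)$ are understood as entire functions of $w$, with removable singularities at $w=0,-1,-2,\dots$ filled in by continuity. The formula for the $\gamma$-derivative comes from $\frac{\partial}{\partial\gamma}\left[\frac{\Gamma(\gamma+k)}{\Gamma(\gamma)}\right]=\frac{\Gamma(\gamma+k)}{\Gamma(\gamma)}\{\psi(\gamma+k)-\psi(\gamma)\}$; at $\gamma=0$, where $\psi(\gamma)$ has a pole, the combined right-hand side is read by continuity, i.e. with this combined coefficient equal to the derivative of $(\gamma)_k$ in $\gamma$. *)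

theory Defs
  imports "HOL-Complex_Analysis.Complex_Analysis"
begin

text \<open>
  The reciprocal \<open>1 / \<Gamma>\<close> is the library's entire function \<^const>\<open>rGamma\<close>, and the quotient
  \<open>\<Gamma>(\<gamma> + k) / \<Gamma>(\<gamma>)\<close> is read as \<open>pochhammer \<gamma> k\<close>, which also covers the poles of \<open>\<Gamma>\<close>.
\<close>

definition prabhakar :: "complex \<Rightarrow> complex \<Rightarrow> complex \<Rightarrow> complex \<Rightarrow> complex" where
  "prabhakar \<alpha> \<beta> \<gamma> z =
     (\<Sum>k. pochhammer \<gamma> k * z ^ k / fact k * rGamma (\<alpha> * of_nat k + \<beta>))"

text \<open>
  The entire function \<open>\<psi>(w) / \<Gamma>(w)\<close>. The library totalises \<^const>\<open>Gamma\<close> and division by 0, so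
  the bare quotient has the wrong value at the poles of \<open>\<Gamma>\<close> (at \<open>-n\<close> it should be
  \<open>(-1)^(n+1) n!\<close>); hence the singularities are removed explicitly.
\<close>

definition Digamma_over_Gamma :: "complex \<Rightarrow> complex" where
  "Digamma_over_Gamma = remove_sings (\<lambda>w. Digamma w / Gamma w)"

text \<open>
  The coefficient \<open>(\<gamma>)\<^sub>k (\<psi>(\<gamma> + k) - \<psi>(\<gamma>))\<close>, with its singularities in \<open>\<gamma>\<close> filled in by continuity.
\<close>

definition pochhammer_Digamma_diff :: "nat \<Rightarrow> complex \<Rightarrow> complex" where
  "pochhammer_Digamma_diff k =
     remove_sings (\<lambda>g. pochhammer g k * (Digamma (g + of_nat k) - Digamma g))"

lemma eventually_at_not_nonpos_Ints: "eventually (\<lambda>u::complex. u \<notin> \<int>\<^sub>\<le>\<^sub>0) (at w)"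
proof -
  have "closed (\<int>\<^sub>\<le>\<^sub>0 - {w})"
    by (rule closed_subset_Ints) auto
  hence "open (- (\<int>\<^sub>\<le>\<^sub>0 - {w}))"
    by (rule open_Compl)
  hence "eventually (\<lambda>u. u \<in> - (\<int>\<^sub>\<le>\<^sub>0 - {w}) - {w}) (at w)"
    by (rule eventually_at_in_open) auto
  thus ?thesis
    by eventually_elim auto
qed

lemma remove_sings_eq_deriv:
  fixes f g :: "complex \<Rightarrow> complex"
  assumes "g holomorphic_on UNIV" and eq: "\<And>u. u \<notin> \<int>\<^sub>\<le>\<^sub>0 \<Longrightarrow> f u = deriv g u"
  shows "remove_sings f w = deriv g w"
proof (rule remove_sings_eqI)
  have "continuous_on UNIV (deriv g)"
    by (intro holomorphic_on_imp_continuous_on holomorphic_deriv assms open_UNIV)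
  hence "deriv g \<midarrow>w\<rightarrow> deriv g w"
    by (simp add: continuous_on_def)
  moreover have "eventually (\<lambda>u. deriv g u = f u) (at w)"
    using eventually_at_not_nonpos_Ints by eventually_elim (simp add: eq)
  ultimately show "f \<midarrow>w\<rightarrow> deriv g w"
    using Lim_transform_eventually by blast
qed

lemma Digamma_over_Gamma_eq_deriv: "Digamma_over_Gamma w = - deriv rGamma w"
proof -
  have "remove_sings (\<lambda>w. Digamma w / Gamma w) w = deriv (\<lambda>u. - rGamma u) w"
  proof (rule remove_sings_eq_deriv)
    show "Digamma u / Gamma u = deriv (\<lambda>u. - rGamma u) u" if "u \<notin> \<int>\<^sub>\<le>\<^sub>0" for u :: complex
      using DERIV_imp_deriv[OF DERIV_minus[OF has_field_derivative_rGamma_no_nonpos_int[OF that]]]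
      by (simp add: rGamma_inverse_Gamma field_simps)
  qed (intro holomorphic_intros)
  moreover have "deriv (\<lambda>u. - rGamma u) w = - deriv rGamma w"
    by (intro DERIV_imp_deriv DERIV_minus)
       (simp add: DERIV_deriv_iff_field_differentiable field_differentiable_rGamma)
  ultimately show ?thesis
    by (simp add: Digamma_over_Gamma_def)
qed

lemma Digamma_over_Gamma_nonpole:
  assumes "w \<notin> \<int>\<^sub>\<le>\<^sub>0"
  shows "Digamma_over_Gamma w = Digamma w / Gamma w"
  using DERIV_imp_deriv[OF has_field_derivative_rGamma_no_nonpos_int[OF assms]]
  by (simp add: Digamma_over_Gamma_eq_deriv rGamma_inverse_Gamma field_simps)

lemma deriv_pochhammer_nonpole:
  fixes \<gamma> :: complex
  assumes "\<gamma> \<notin> \<int>\<^sub>\<le>\<^sub>0"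
  shows "deriv (\<lambda>g. pochhammer g k) \<gamma> =
           pochhammer \<gamma> k * (Digamma (\<gamma> + of_nat k) - Digamma \<gamma>)"
proof -
  have "((\<lambda>g. pochhammer g k) has_field_derivative
             pochhammer \<gamma> k * (Digamma (\<gamma> + of_nat k) - Digamma \<gamma>)) (at \<gamma>)"
  proof (induction k)
    case 0
    show ?case by simp
  next
    case (Suc k)
    have nz: "\<gamma> + of_nat k \<noteq> 0"
      using assms by (metis add_eq_0_iff2 minus_of_nat_in_nonpos_Ints)
    have psi: "Digamma (\<gamma> + of_nat (Suc k)) = Digamma (\<gamma> + of_nat k) + 1 / (\<gamma> + of_nat k)"
      using Digamma_plus1[OF nz] by (simp add: add_ac)
    have val: "pochhammer \<gamma> (Suc k) * (Digamma (\<gamma> + of_nat (Suc k)) - Digamma \<gamma>) =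
        pochhammer \<gamma> k * (Digamma (\<gamma> + of_nat k) - Digamma \<gamma>) * (\<gamma> + of_nat k) + pochhammer \<gamma> k"
      unfolding psi pochhammer_Suc using nz by (simp add: divide_simps) (simp add: algebra_simps)
    have "((\<lambda>g. pochhammer g k * (g + of_nat k)) has_field_derivative
        pochhammer \<gamma> k * (Digamma (\<gamma> + of_nat k) - Digamma \<gamma>) * (\<gamma> + of_nat k) + pochhammer \<gamma> k) (at \<gamma>)"
      by (rule derivative_eq_intros Suc.IH refl)+ simp
    thus ?case
      by (simp only: val pochhammer_Suc[symmetric])
  qed
  thus ?thesis by (rule DERIV_imp_deriv)
qed

lemma pochhammer_Digamma_diff_eq_deriv:
  "pochhammer_Digamma_diff k \<gamma> = deriv (\<lambda>g. pochhammer g k) \<gamma>"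
  unfolding pochhammer_Digamma_diff_def
  by (rule remove_sings_eq_deriv) (auto intro!: holomorphic_intros simp: deriv_pochhammer_nonpole)

end

theory Submission
  imports Defs
begin

text \<open>
  For \<open>x = Re w > 1\<close> the product formula gives
  \<open>\<bar>1 / \<Gamma>(w)\<bar> \<le> exp ((Im w)\<^sup>2 / (x - 1)) / \<Gamma>(x)\<close>, and \<open>1 / \<Gamma>(x)\<close> decays faster than every
  exponential. On \<open>w = \<alpha> k + \<beta>\<close> with \<open>Re \<alpha> > 0\<close> the exponent \<open>(Im w)\<^sup>2 / (x - 1)\<close> is only \<open>O(k)\<close>, so
  the terms of the series are dominated by a geometric series, uniformly for parameters near
  \<open>(\<alpha>, \<beta>, \<gamma>)\<close>. Each parameter can then be differentiated under the sum by Weierstrass' theorem.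
\<close>

section \<open>Decay of \<open>1 / \<Gamma>\<close> in the right half-plane\<close>

text \<open>With x = Re w + n and y = Im w, each factor satisfies |w + n| = x sqrt (1 + y^2 / x^2)
  \<le> x exp (y^2 / (2 x^2)), and 1 / (2 x^2) is at most 1 / (x - 1) - 1 / x. These differences
  telescope over the factors, which yields the closed exponent.\<close>

lemma norm_pochhammer_le_real:
  fixes w :: complex
  assumes "Re w > 1"
  shows "norm (pochhammer w n) \<le> pochhammer (Re w) n *
           exp ((Im w)\<^sup>2 * (1 / (Re w - 1) - 1 / (Re w + real n - 1)))"
proof (induction n)
  case 0
  show ?case by simp
next
  case (Suc n)
  define x y where "x = Re w + real n" and "y = Im w"
  have x: "x > 1"
    using assms by (simp add: x_def)
  have "norm (w + of_nat n) = sqrt (x\<^sup>2 + y\<^sup>2)"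
    by (simp add: cmod_def x_def y_def)
  also have "\<dots> \<le> x * exp (y\<^sup>2 * (1 / (x - 1) - 1 / x))"
  proof (rule real_le_lsqrt)
    have "x\<^sup>2 + y\<^sup>2 = x\<^sup>2 * (1 + y\<^sup>2 * (1 / x\<^sup>2))"
      using x by (simp add: field_simps)
    \<comment> \<open>The difference equals 1 / (x (x - 1)). The factor 2 is the one that appears in
      the exponent when the target bound is squared.\<close>
    also have "1 / x\<^sup>2 \<le> 2 * (1 / (x - 1) - 1 / x)"
      using x by (simp add: divide_simps power2_eq_square)
    hence "1 + y\<^sup>2 * (1 / x\<^sup>2) \<le> 1 + y\<^sup>2 * (2 * (1 / (x - 1) - 1 / x))"
      by (intro add_left_mono mult_left_mono) auto
    hence "x\<^sup>2 * (1 + y\<^sup>2 * (1 / x\<^sup>2)) \<le> x\<^sup>2 * exp (y\<^sup>2 * (2 * (1 / (x - 1) - 1 / x)))"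
      by (intro mult_left_mono order.trans[OF _ exp_ge_add_one_self]) auto
    also have "\<dots> = (x * exp (y\<^sup>2 * (1 / (x - 1) - 1 / x)))\<^sup>2"
      by (simp add: power_mult_distrib exp_double[symmetric] mult_ac)
    finally show "x\<^sup>2 + y\<^sup>2 \<le> (x * exp (y\<^sup>2 * (1 / (x - 1) - 1 / x)))\<^sup>2" .
  qed (use x in auto)
  finally have step: "norm (w + of_nat n) \<le> x * exp (y\<^sup>2 * (1 / (x - 1) - 1 / x))" .
  have nonneg: "0 \<le> pochhammer (Re w) n"
    using assms by (intro pochhammer_nonneg) auto
  have "norm (pochhammer w (Suc n)) = norm (pochhammer w n) * norm (w + of_nat n)"
    by (simp add: pochhammer_Suc norm_mult)
  also have "\<dots> \<le> pochhammer (Re w) n * exp (y\<^sup>2 * (1 / (Re w - 1) - 1 / (x - 1))) *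
                    (x * exp (y\<^sup>2 * (1 / (x - 1) - 1 / x)))"
    using Suc.IH step nonneg by (intro mult_mono) (auto simp: x_def y_def)
  also have "\<dots> = pochhammer (Re w) n * x *
      exp (y\<^sup>2 * (1 / (Re w - 1) - 1 / (x - 1)) + y\<^sup>2 * (1 / (x - 1) - 1 / x))"
    by (simp add: exp_add)
  also have "y\<^sup>2 * (1 / (Re w - 1) - 1 / (x - 1)) + y\<^sup>2 * (1 / (x - 1) - 1 / x) =
             y\<^sup>2 * (1 / (Re w - 1) - 1 / x)"
    by (simp add: algebra_simps)
  finally show ?case
    by (simp add: pochhammer_Suc x_def y_def)
qed

text \<open>In \<open>rGamma_series w n\<close> the denominator n! n^w has the same modulus as the
  one at Re w, so the comparison of Pochhammer symbols carries over to the series and survives the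
  limit. The subtracted end of the telescoped exponent is dropped to get a bound uniform in
  n.\<close>

lemma norm_rGamma_le_real:
  fixes w :: complex
  assumes "Re w > 1"
  shows "norm (rGamma w) \<le> rGamma (Re w) * exp ((Im w)\<^sup>2 / (Re w - 1))"
proof (rule tendsto_le)
  show "(\<lambda>n. norm (rGamma_series w n)) \<longlonglongrightarrow> norm (rGamma w)"
    by (intro tendsto_intros)
  show "(\<lambda>n. rGamma_series (Re w) n * exp ((Im w)\<^sup>2 / (Re w - 1)))
          \<longlonglongrightarrow> rGamma (Re w) * exp ((Im w)\<^sup>2 / (Re w - 1))"
    by (intro tendsto_intros)
  have "norm (rGamma_series w n) \<le> rGamma_series (Re w) n * exp ((Im w)\<^sup>2 / (Re w - 1))" for n
  proof -
    have "(Im w)\<^sup>2 * (1 / (Re w - 1) - 1 / (Re w + real (n + 1) - 1)) \<le> (Im w)\<^sup>2 * (1 / (Re w - 1))"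
      using assms by (intro mult_left_mono) auto
    hence "norm (pochhammer w (n + 1)) \<le>
             pochhammer (Re w) (n + 1) * exp ((Im w)\<^sup>2 / (Re w - 1))"
      using assms
      by (intro order.trans[OF norm_pochhammer_le_real] mult_left_mono pochhammer_nonneg) auto
    thus ?thesis
      by (simp add: rGamma_series_def norm_divide norm_mult divide_right_mono)
  qed
  thus "\<forall>\<^sub>F n in sequentially. norm (rGamma_series w n) \<le>
          rGamma_series (Re w) n * exp ((Im w)\<^sup>2 / (Re w - 1))"
    by simp
qed auto

text \<open>By the functional equation, \<open>f x = f (x + 1) * (x * exp (- L))\<close>, so the
  weighted function \<open>f\<close> does not grow under unit shifts once x is at least
  \<open>exp L\<close>. A bound on a compact interval therefore propagates to all larger x.\<close>

lemma rGamma_real_superexponential_decay: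
  obtains M where "M \<ge> 0" "\<And>x::real. x \<ge> 1 \<Longrightarrow> rGamma x \<le> M * exp (- L * x)"
proof -
  define f where "f = (\<lambda>x::real. rGamma x * exp (L * x))"
  have nonneg: "f x \<ge> 0" if "x \<ge> 1" for x
    using that by (simp add: f_def rGamma_inverse_Gamma)
  \<comment> \<open>The margin 2 puts \<open>x - 1\<close> above both \<open>exp L\<close> and 1 for
    every x beyond the interval, so that \<open>step\<close> applies at
    \<open>x - 1\<close>.\<close>
  have "bounded (f ` {1..exp L + 2})"
    unfolding f_def by (intro compact_imp_bounded compact_continuous_image continuous_intros) auto
  then obtain M where M: "M > 0" "\<And>x. x \<in> {1..exp L + 2} \<Longrightarrow> norm (f x) \<le> M"
    unfolding bounded_pos by auto
  have step: "f (x + 1) \<le> f x" if "x \<ge> exp L" "x \<ge> 1" for x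
  proof -
    have "f x = f (x + 1) * (x * exp (- L))"
      by (simp add: f_def rGamma_plus1[of x, symmetric] exp_minus algebra_simps exp_add)
    moreover have "x * exp (- L) \<ge> 1"
      using that by (simp add: exp_minus field_simps)
    ultimately show ?thesis
      using mult_left_mono[of 1 "x * exp (- L)" "f (x + 1)"] nonneg[of "x + 1"] that by simp
  qed
  have bound: "f x \<le> M" if "1 \<le> x" "x \<le> exp L + 2 + real n" for x n
    using that
  proof (induction n arbitrary: x)
    case 0
    thus ?case using M(2)[of x] by auto
  next
    case (Suc n)
    show ?case
    proof (cases "x \<le> exp L + 2")
      case True
      thus ?thesis using M(2)[of x] Suc.prems by auto
    next
      case False
      hence "exp L \<le> x - 1" "1 \<le> x - 1"
        using exp_gt_zero[of L] by linarith+
      thus ?thesis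
        using step[of "x - 1"] Suc.IH[of "x - 1"] Suc.prems by simp
    qed
  qed
  have "rGamma x \<le> M * exp (- L * x)" if "x \<ge> 1" for x
  proof -
    obtain n where "x - (exp L + 2) \<le> real n"
      using real_arch_simple by blast
    hence "f x \<le> M"
      using that by (intro bound[of x n]) auto
    thus ?thesis
      by (simp add: f_def exp_minus field_simps)
  qed
  with M(1) show thesis
    by (intro that[of M]) auto
qed

section \<open>A geometric majorant, locally uniform in the parameters\<close>

text \<open>Each factor |c + k| is at most (C + 1) (k + 1). The factorial collected this way cancels
  the one in the series, leaving only geometric growth.\<close>

lemma norm_pochhammer_le_power:
  fixes c :: "'a :: real_normed_field"
  assumes "norm c \<le> C"
  shows "norm (pochhammer c k) \<le> (C + 1) ^ k * fact k"
proof (induction k)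
  case (Suc k)
  have C: "C \<ge> 0"
    using assms norm_ge_zero order.trans by blast
  have "norm (c + of_nat k) \<le> C + real k"
    using norm_triangle_ineq[of c "of_nat k"] assms by simp
  also have "\<dots> \<le> (C + 1) * (real k + 1)"
    using C by (simp add: algebra_simps)
  finally have "norm (pochhammer c (Suc k)) \<le> ((C + 1) ^ k * fact k) * ((C + 1) * (real k + 1))"
    unfolding pochhammer_Suc norm_mult using Suc C by (intro mult_mono) auto
  thus ?case
    by (simp add: mult_ac add_ac)
qed auto

text \<open>Off the real axis \<open>rGamma\<close> costs a factor exp (D k), and the remaining
  factors cost Q^k. Since the decay rate L of \<open>rGamma\<close> on the real axis is free, it can
  be chosen to beat both. One radius serves all three parameters, so each can be varied separately
  later.\<close>

lemma prabhakar_terms_dominated: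
  fixes \<alpha> \<beta> \<gamma> z :: complex
  assumes "Re \<alpha> > 0"
  obtains d M where "d > 0"
    "\<forall>\<^sub>F k in sequentially. \<forall>a\<in>ball \<alpha> d. \<forall>b\<in>ball \<beta> d. \<forall>c\<in>ball \<gamma> d.
       norm (pochhammer c k * z ^ k / fact k * rGamma (a * of_nat k + b)) \<le> M * (1/2) ^ k"
proof -
  \<comment> \<open>Half of Re \<alpha> keeps Re a \<ge> d for all a in the ball.\<close>
  define d where "d = Re \<alpha> / 2"
  define A B C where "A = norm \<alpha> + d" and "B = norm \<beta> + d" and "C = norm \<gamma> + d"
  \<comment> \<open>For w = a k + b and large k, |Im w| \<le> (A + 1) k and Re w - 1 \<ge> d k / 2,
    hence (Im w)^2 / (Re w - 1) \<le> D k.\<close>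
  define D where "D = 2 * (A + 1)\<^sup>2 / d"
  \<comment> \<open>Adding 1 to |z| forces Q \<ge> 1, so that L \<ge> 0 and the lower bound on Re w
    becomes an upper bound on exp (- L Re w).\<close>
  define Q where "Q = (C + 1) * (norm z + 1)"
  \<comment> \<open>The solution of exp (D - L d / 2) Q = 1 / 2.\<close>
  define L where "L = 2 / d * (D + ln (2 * Q))"
  have d: "d > 0"
    using assms by (simp add: d_def)
  have pos: "A > 0" "B > 0" "C > 0"
    using d by (simp_all add: A_def B_def C_def add_nonneg_pos)
  have "Q \<ge> 1 * 1"
    unfolding Q_def using pos by (intro mult_mono) auto
  hence Q: "Q \<ge> 1" by simp
  have "L \<ge> 0"
    using d Q by (simp add: L_def D_def)
  have "D - L * d / 2 = - ln (2 * Q)"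
    using d by (simp add: L_def) argo
  hence L: "exp (D - L * d / 2) * Q = 1 / 2"
    using Q by (simp add: exp_minus)
  obtain M where M: "M \<ge> 0" "\<And>x::real. x \<ge> 1 \<Longrightarrow> rGamma x \<le> M * exp (- L * x)"
    using rGamma_real_superexponential_decay[of L] by blast
  \<comment> \<open>The second threshold on k gives d k - B \<ge> d k / 2 + 2, which bounds Re w
    from below; the third absorbs |b| into (A + 1) k.\<close>
  have bound: "norm (pochhammer c k * z ^ k / fact k * rGamma (a * of_nat k + b)) \<le> M * (1/2) ^ k"
    if k: "real k \<ge> 1" "real k \<ge> 2 / d * (B + 2)" "real k \<ge> B"
      and a: "a \<in> ball \<alpha> d" and b: "b \<in> ball \<beta> d" and c: "c \<in> ball \<gamma> d" for k a b c
  proof -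
    define w where "w = a * of_nat k + b"
    have na: "norm a \<le> A" and nb: "norm b \<le> B" and nc: "norm c \<le> C"
      using a b c norm_triangle_sub[of a \<alpha>] norm_triangle_sub[of b \<beta>] norm_triangle_sub[of c \<gamma>]
      by (simp_all add: A_def B_def C_def dist_norm norm_minus_commute)
    have "Re \<alpha> - Re a \<le> d"
      using a abs_Re_le_cmod[of "\<alpha> - a"] by (simp add: dist_norm)
    hence "d * real k \<le> Re a * real k"
      by (intro mult_right_mono) (auto simp: d_def)
    moreover have "- B \<le> Re b"
      using nb abs_Re_le_cmod[of b] by linarith
    moreover have "d * real k \<ge> d / 2 * real k + (B + 2)"
      using k(2) d by (simp add: field_simps)
    ultimately have x: "Re w \<ge> d / 2 * real k + 2"
      by (simp add: w_def)
    have "\<bar>Im w\<bar> \<le> norm w"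
      by (rule abs_Im_le_cmod)
    also have "\<dots> \<le> norm (a * of_nat k) + norm b"
      unfolding w_def by (rule norm_triangle_ineq)
    also have "\<dots> \<le> A * real k + real k"
      using na nb k(3) by (intro add_mono) (auto simp: norm_mult intro: mult_right_mono)
    finally have y: "\<bar>Im w\<bar> \<le> (A + 1) * real k"
      by (simp add: algebra_simps)
    have dk: "d / 2 * real k > 0"
      using d k(1) by simp
    have "(Im w)\<^sup>2 / (Re w - 1) \<le> ((A + 1) * real k)\<^sup>2 / (d / 2 * real k)"
      using x y dk by (intro frac_le) (auto simp: abs_le_square_iff[symmetric])
    also have "\<dots> = D * real k"
      using k(1) d by (simp add: D_def field_simps power2_eq_square)
    finally have D: "(Im w)\<^sup>2 / (Re w - 1) \<le> D * real k" .
    have "L * (d / 2 * real k) \<le> L * Re w"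
      using \<open>L \<ge> 0\<close> x by (intro mult_left_mono) auto
    hence E: "- L * Re w + (Im w)\<^sup>2 / (Re w - 1) \<le> real k * (D - L * d / 2)"
      using D by (simp add: algebra_simps)
    have "norm (rGamma w) \<le> rGamma (Re w) * exp ((Im w)\<^sup>2 / (Re w - 1))"
      using x dk by (intro norm_rGamma_le_real) auto
    also have "\<dots> \<le> (M * exp (- L * Re w)) * exp ((Im w)\<^sup>2 / (Re w - 1))"
      using x dk by (intro mult_right_mono M(2)) auto
    also have "\<dots> = M * exp (- L * Re w + (Im w)\<^sup>2 / (Re w - 1))"
      by (simp only: exp_add mult.assoc)
    also have "\<dots> \<le> M * exp (real k * (D - L * d / 2))"
      using E M(1) by (intro mult_left_mono) auto
    finally have G: "norm (rGamma w) \<le> M * exp (D - L * d / 2) ^ k"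
      by (simp add: exp_of_nat_mult)
    have "norm (pochhammer c k * z ^ k / fact k) \<le> (C + 1) ^ k * fact k * (norm z + 1) ^ k / fact k"
      unfolding norm_divide norm_mult norm_power norm_fact
      using pos by (intro divide_right_mono mult_mono norm_pochhammer_le_power nc power_mono) auto
    also have "\<dots> = Q ^ k"
      by (simp add: Q_def power_mult_distrib)
    finally have "norm (pochhammer c k * z ^ k / fact k * rGamma w) \<le>
        Q ^ k * (M * exp (D - L * d / 2) ^ k)"
      unfolding norm_mult using G Q by (intro mult_mono) auto
    also have "\<dots> = M * (exp (D - L * d / 2) * Q) ^ k"
      by (simp add: power_mult_distrib)
    finally show ?thesis
      by (simp add: L w_def)
  qed
  have "\<forall>\<^sub>F k in sequentially. real k \<ge> 1 \<and> real k \<ge> 2 / d * (B + 2) \<and> real k \<ge> B"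
    using filterlim_real_sequentially by (auto simp: filterlim_at_top eventually_conj_iff)
  hence "\<forall>\<^sub>F k in sequentially. \<forall>a\<in>ball \<alpha> d. \<forall>b\<in>ball \<beta> d. \<forall>c\<in>ball \<gamma> d.
       norm (pochhammer c k * z ^ k / fact k * rGamma (a * of_nat k + b)) \<le> M * (1/2) ^ k"
    by eventually_elim (use bound in blast)
  with d show thesis
    by (rule that)
qed

section \<open>Differentiation under the sum\<close>

text \<open>Local domination of the terms alone also controls their derivatives, because locally
  uniform convergence of holomorphic functions passes to derivatives. The limit functions are
  restated as \<open>suminf\<close> to match \<open>prabhakar\<close>.\<close>

lemma has_field_derivative_suminf_dominated:
  fixes f f' :: "nat \<Rightarrow> complex \<Rightarrow> complex"
  assumes "open S" and "x \<in> S"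
    and deriv: "\<And>n y. y \<in> S \<Longrightarrow> (f n has_field_derivative f' n y) (at y)"
    and dom: "\<And>y. y \<in> S \<Longrightarrow> \<exists>d h. d > 0 \<and> summable h \<and>
                (\<forall>\<^sub>F n in sequentially. \<forall>u\<in>ball y d. norm (f n u) \<le> h n)"
  shows "(\<lambda>n. f n x) sums (\<Sum>n. f n x)"
    and "(\<lambda>n. f' n x) sums (\<Sum>n. f' n x)"
    and "((\<lambda>y. \<Sum>n. f n y) has_field_derivative (\<Sum>n. f' n x)) (at x)"
proof -
  have "\<exists>d h. 0 < d \<and> summable h \<and>
           (\<forall>\<^sub>F n in sequentially. \<forall>u\<in>ball y d \<inter> S. norm (f n u) \<le> h n)" if y: "y \<in> S" for y
  proof -
    obtain d h where "d > 0" "summable h"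
      and ev: "\<forall>\<^sub>F n in sequentially. \<forall>u\<in>ball y d. norm (f n u) \<le> h n"
      using dom[OF y] by blast
    moreover from ev have "\<forall>\<^sub>F n in sequentially. \<forall>u\<in>ball y d \<inter> S. norm (f n u) \<le> h n"
      by eventually_elim blast
    ultimately show ?thesis by blast
  qed
  from series_and_derivative_comparison_local[OF \<open>open S\<close> deriv this]
  obtain g g' where g: "\<And>y. y \<in> S \<Longrightarrow> (\<lambda>n. f n y) sums g y"
    and g': "\<And>y. y \<in> S \<Longrightarrow> (\<lambda>n. f' n y) sums g' y"
    and D: "\<And>y. y \<in> S \<Longrightarrow> (g has_field_derivative g' y) (at y)"
    by blast
  show "(\<lambda>n. f n x) sums (\<Sum>n. f n x)" "(\<lambda>n. f' n x) sums (\<Sum>n. f' n x)"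
    using g[OF \<open>x \<in> S\<close>] g'[OF \<open>x \<in> S\<close>] by (auto simp: sums_iff)
  \<comment> \<open>The sum is known to agree with \<open>g\<close> only on \<open>S\<close>; as
    \<open>S\<close> is open, this is agreement near \<open>x\<close>, enough to transfer the
    derivative.\<close>
  have "((\<lambda>y. \<Sum>n. f n y) has_field_derivative g' x) (at x)"
    by (rule has_field_derivative_transform_within_open[OF D[OF \<open>x \<in> S\<close>] \<open>open S\<close> \<open>x \<in> S\<close>])
       (use g in \<open>simp add: sums_iff\<close>)
  thus "((\<lambda>y. \<Sum>n. f n y) has_field_derivative (\<Sum>n. f' n x)) (at x)"
    using g'[OF \<open>x \<in> S\<close>] by (simp add: sums_iff)
qed

text \<open>The filled-in quotient is -(1 / \<Gamma>)' everywhere, so the chain rule also covers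
  terms in which \<alpha> k + \<beta> hits a pole of \<Gamma>.\<close>

lemma has_field_derivative_rGamma_Digamma_over_Gamma [derivative_intros]:
  assumes "(f has_field_derivative f') (at x within A)"
  shows "((\<lambda>x. rGamma (f x)) has_field_derivative - Digamma_over_Gamma (f x) * f') (at x within A)"
proof (rule DERIV_chain2[OF _ assms])
  show "(rGamma has_field_derivative - Digamma_over_Gamma (f x)) (at (f x))"
    by (simp add: Digamma_over_Gamma_eq_deriv DERIV_deriv_iff_field_differentiable
        field_differentiable_rGamma)
qed

lemma has_field_derivative_pochhammer_Digamma_diff:
  "((\<lambda>c. pochhammer c k) has_field_derivative pochhammer_Digamma_diff k c) (at c)"
proof -
  have "(\<lambda>c::complex. pochhammer c k) holomorphic_on UNIV"
    by (intro holomorphic_intros)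
  thus ?thesis
    unfolding pochhammer_Digamma_diff_eq_deriv
    by (rule holomorphic_derivI) auto
qed

lemma summable_mult_half_power: "summable (\<lambda>k. M * (1/2) ^ k :: real)"
  by (intro summable_mult summable_geometric) auto

section \<open>Derivatives of the Prabhakar function in each parameter\<close>

lemma prabhakar_deriv_alpha:
  fixes \<alpha> \<beta> \<gamma> z :: complex
  assumes "Re \<alpha> > 0"
  defines "f' \<equiv> (\<lambda>k. of_nat k * Digamma_over_Gamma (\<alpha> * of_nat k + \<beta>) * pochhammer \<gamma> k / fact k * z ^ k)"
  shows "summable f'" and "((\<lambda>a. prabhakar a \<beta> \<gamma> z) has_field_derivative - suminf f') (at \<alpha>)"
proof -
  define F where "F = (\<lambda>k a. pochhammer \<gamma> k * z ^ k / fact k * rGamma (a * of_nat k + \<beta>))"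
  define G where "G = (\<lambda>k a. - (of_nat k * Digamma_over_Gamma (a * of_nat k + \<beta>) *
                         pochhammer \<gamma> k / fact k * z ^ k))"
  have F: "(F k has_field_derivative G k a) (at a)" for k a
    unfolding F_def G_def by (auto intro!: derivative_eq_intros)
  have dom: "\<exists>d h. d > 0 \<and> summable h \<and>
               (\<forall>\<^sub>F k in sequentially. \<forall>u\<in>ball a d. norm (F k u) \<le> h k)"
    if "a \<in> {a. Re a > 0}" for a
  proof -
    obtain d M where "d > 0"
      and ev: "\<forall>\<^sub>F k in sequentially. \<forall>a\<in>ball a d. \<forall>b\<in>ball \<beta> d. \<forall>c\<in>ball \<gamma> d.
        norm (pochhammer c k * z ^ k / fact k * rGamma (a * of_nat k + b)) \<le> M * (1/2) ^ k"
      using prabhakar_terms_dominated \<open>a \<in> _\<close> by blast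
    \<comment> \<open>The joint majorant is specialised by placing \<beta> and \<gamma> at the
      centres of their balls.\<close>
    from ev have "\<forall>\<^sub>F k in sequentially. \<forall>u\<in>ball a d. norm (F k u) \<le> M * (1/2) ^ k"
      by eventually_elim (use \<open>d > 0\<close> in \<open>simp add: F_def\<close>)
    with \<open>d > 0\<close> summable_mult_half_power show ?thesis by blast
  qed
  have G: "(\<lambda>k. G k \<alpha>) = (\<lambda>k. - f' k)"
    by (simp add: G_def f'_def)
  note D = has_field_derivative_suminf_dominated[OF open_halfspace_Re_gt _ F dom, of \<alpha>]
  have "summable (\<lambda>k. - f' k)"
    using D(2) assms(1) by (simp add: G sums_iff)
  thus "summable f'" by (simp add: summable_minus_iff)
  thus "((\<lambda>a. prabhakar a \<beta> \<gamma> z) has_field_derivative - suminf f') (at \<alpha>)"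
    using D(3) assms(1) by (simp add: G suminf_minus prabhakar_def F_def)
qed

text \<open>The domain of differentiation is now the whole plane, since domination around any
  \<beta> requires only Re \<alpha> > 0.\<close>

lemma prabhakar_deriv_beta:
  fixes \<alpha> \<beta> \<gamma> z :: complex
  assumes "Re \<alpha> > 0"
  defines "f' \<equiv> (\<lambda>k. Digamma_over_Gamma (\<alpha> * of_nat k + \<beta>) * pochhammer \<gamma> k / fact k * z ^ k)"
  shows "summable f'" and "((\<lambda>b. prabhakar \<alpha> b \<gamma> z) has_field_derivative - suminf f') (at \<beta>)"
proof -
  define F where "F = (\<lambda>k b. pochhammer \<gamma> k * z ^ k / fact k * rGamma (\<alpha> * of_nat k + b))"
  define G where "G = (\<lambda>k b. - (Digamma_over_Gamma (\<alpha> * of_nat k + b) *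
                         pochhammer \<gamma> k / fact k * z ^ k))"
  have F: "(F k has_field_derivative G k b) (at b)" for k b
    unfolding F_def G_def by (auto intro!: derivative_eq_intros)
  have dom: "\<exists>d h. d > 0 \<and> summable h \<and>
               (\<forall>\<^sub>F k in sequentially. \<forall>u\<in>ball b d. norm (F k u) \<le> h k)" for b
  proof -
    obtain d M where "d > 0"
      and ev: "\<forall>\<^sub>F k in sequentially. \<forall>a\<in>ball \<alpha> d. \<forall>b\<in>ball b d. \<forall>c\<in>ball \<gamma> d.
        norm (pochhammer c k * z ^ k / fact k * rGamma (a * of_nat k + b)) \<le> M * (1/2) ^ k"
      using prabhakar_terms_dominated assms(1) by blast
    from ev have "\<forall>\<^sub>F k in sequentially. \<forall>u\<in>ball b d. norm (F k u) \<le> M * (1/2) ^ k"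
      by eventually_elim (use \<open>d > 0\<close> in \<open>simp add: F_def\<close>)
    with \<open>d > 0\<close> summable_mult_half_power show ?thesis by blast
  qed
  have G: "(\<lambda>k. G k \<beta>) = (\<lambda>k. - f' k)"
    by (simp add: G_def f'_def)
  note D = has_field_derivative_suminf_dominated[OF open_UNIV UNIV_I F dom, of \<beta>]
  have "summable (\<lambda>k. - f' k)"
    using D(2) by (simp add: G sums_iff)
  thus "summable f'" by (simp add: summable_minus_iff)
  thus "((\<lambda>b. prabhakar \<alpha> b \<gamma> z) has_field_derivative - suminf f') (at \<beta>)"
    using D(3) by (simp add: G suminf_minus prabhakar_def F_def)
qed

text \<open>Convergence of the defining series is recorded as well; it is what later allows the
  \<gamma>-derivative to be split into two series.\<close>

lemma prabhakar_deriv_gamma: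
  fixes \<alpha> \<beta> \<gamma> z :: complex
  assumes "Re \<alpha> > 0"
  defines "f' \<equiv> (\<lambda>k. pochhammer_Digamma_diff k \<gamma> / fact k * rGamma (\<alpha> * of_nat k + \<beta>) * z ^ k)"
  shows "(\<lambda>k. pochhammer \<gamma> k * z ^ k / fact k * rGamma (\<alpha> * of_nat k + \<beta>)) sums prabhakar \<alpha> \<beta> \<gamma> z"
    and "f' sums suminf f'"
    and "((\<lambda>c. prabhakar \<alpha> \<beta> c z) has_field_derivative suminf f') (at \<gamma>)"
proof -
  define F where "F = (\<lambda>k c. pochhammer c k * z ^ k / fact k * rGamma (\<alpha> * of_nat k + \<beta>))"
  define G where "G = (\<lambda>k c. pochhammer_Digamma_diff k c / fact k * rGamma (\<alpha> * of_nat k + \<beta>) * z ^ k)"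
  have F: "(F k has_field_derivative G k c) (at c)" for k c
    unfolding F_def G_def
    by (auto intro!: derivative_eq_intros has_field_derivative_pochhammer_Digamma_diff)
  have dom: "\<exists>d h. d > 0 \<and> summable h \<and>
               (\<forall>\<^sub>F k in sequentially. \<forall>u\<in>ball c d. norm (F k u) \<le> h k)" for c
  proof -
    obtain d M where "d > 0"
      and ev: "\<forall>\<^sub>F k in sequentially. \<forall>a\<in>ball \<alpha> d. \<forall>b\<in>ball \<beta> d. \<forall>c\<in>ball c d.
        norm (pochhammer c k * z ^ k / fact k * rGamma (a * of_nat k + b)) \<le> M * (1/2) ^ k"
      using prabhakar_terms_dominated assms(1) by blast
    from ev have "\<forall>\<^sub>F k in sequentially. \<forall>u\<in>ball c d. norm (F k u) \<le> M * (1/2) ^ k"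
      by eventually_elim (use \<open>d > 0\<close> in \<open>simp add: F_def\<close>)
    with \<open>d > 0\<close> summable_mult_half_power show ?thesis by blast
  qed
  note D = has_field_derivative_suminf_dominated[OF open_UNIV UNIV_I F dom, of \<gamma>]
  show "(\<lambda>k. pochhammer \<gamma> k * z ^ k / fact k * rGamma (\<alpha> * of_nat k + \<beta>)) sums prabhakar \<alpha> \<beta> \<gamma> z"
    "f' sums suminf f'" "((\<lambda>c. prabhakar \<alpha> \<beta> c z) has_field_derivative suminf f') (at \<gamma>)"
    using D by (simp_all add: F_def G_def f'_def prabhakar_def)
qed

section \<open>The stated formulas, with \<gamma> = 0 treated separately\<close>

theorem corollary2p3:
  fixes \<alpha> \<beta> \<gamma> z :: complex
  assumes "Re \<alpha> > 0"
    and "\<forall>n::nat. n \<ge> 1 \<longrightarrow> \<gamma> \<noteq> - of_nat n"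
  shows "(\<lambda>k. pochhammer \<gamma> k * z ^ k / fact k * rGamma (\<alpha> * of_nat k + \<beta>)) sums prabhakar \<alpha> \<beta> \<gamma> z
    \<and> (\<gamma> \<noteq> 0 \<longrightarrow>
        (\<lambda>k. Gamma (\<gamma> + of_nat k) * z ^ k / (Gamma \<gamma> * fact k) * rGamma (\<alpha> * of_nat k + \<beta>))
          sums prabhakar \<alpha> \<beta> \<gamma> z)
    \<and> (\<exists>S. (\<lambda>k. of_nat (Suc k) * Digamma_over_Gamma (\<alpha> * of_nat (Suc k) + \<beta>)
                  * pochhammer \<gamma> (Suc k) / fact (Suc k) * z ^ Suc k) sums S
         \<and> ((\<lambda>a. prabhakar a \<beta> \<gamma> z) has_field_derivative - S) (at \<alpha>))
    \<and> (\<exists>S. (\<lambda>k. Digamma_over_Gamma (\<alpha> * of_nat k + \<beta>)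
                  * pochhammer \<gamma> k / fact k * z ^ k) sums S
         \<and> ((\<lambda>b. prabhakar \<alpha> b \<gamma> z) has_field_derivative - S) (at \<beta>))
    \<and> (\<gamma> \<noteq> 0 \<longrightarrow>
        (\<exists>S T. (\<lambda>k. Digamma (\<gamma> + of_nat k) * pochhammer \<gamma> k / fact k
                      * rGamma (\<alpha> * of_nat k + \<beta>) * z ^ k) sums S
             \<and> (\<lambda>k. pochhammer \<gamma> k * z ^ k / fact k * rGamma (\<alpha> * of_nat k + \<beta>)) sums T
             \<and> ((\<lambda>c. prabhakar \<alpha> \<beta> c z) has_field_derivative S - Digamma \<gamma> * T) (at \<gamma>)))
    \<and> (\<gamma> = 0 \<longrightarrow>
        (\<exists>S. (\<lambda>k. pochhammer_Digamma_diff k \<gamma> / fact k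
                    * rGamma (\<alpha> * of_nat k + \<beta>) * z ^ k) sums S
           \<and> ((\<lambda>c. prabhakar \<alpha> \<beta> c z) has_field_derivative S) (at \<gamma>)))"
proof (intro conjI impI)
  note gamma = prabhakar_deriv_gamma[OF assms(1), where \<beta> = \<beta> and \<gamma> = \<gamma> and z = z]
  show conv: "(\<lambda>k. pochhammer \<gamma> k * z ^ k / fact k * rGamma (\<alpha> * of_nat k + \<beta>))
                sums prabhakar \<alpha> \<beta> \<gamma> z"
    by (rule gamma(1))
  have nonpole: "\<gamma> \<notin> \<int>\<^sub>\<le>\<^sub>0" if "\<gamma> \<noteq> 0"
  proof
    assume "\<gamma> \<in> \<int>\<^sub>\<le>\<^sub>0"
    then obtain n where "\<gamma> = - of_nat n"
      by (elim nonpos_Ints_cases')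
    with assms(2) that show False
      by (cases n) auto
  qed
  show "(\<lambda>k. Gamma (\<gamma> + of_nat k) * z ^ k / (Gamma \<gamma> * fact k) * rGamma (\<alpha> * of_nat k + \<beta>))
          sums prabhakar \<alpha> \<beta> \<gamma> z" if "\<gamma> \<noteq> 0"
    using conv by (simp add: pochhammer_Gamma[OF nonpole[OF that]] field_simps)
  show "\<exists>S. (\<lambda>k. of_nat (Suc k) * Digamma_over_Gamma (\<alpha> * of_nat (Suc k) + \<beta>)
                  * pochhammer \<gamma> (Suc k) / fact (Suc k) * z ^ Suc k) sums S
         \<and> ((\<lambda>a. prabhakar a \<beta> \<gamma> z) has_field_derivative - S) (at \<alpha>)"
  proof -
    define f' where "f' = (\<lambda>k. of_nat k * Digamma_over_Gamma (\<alpha> * of_nat k + \<beta>)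
                             * pochhammer \<gamma> k / fact k * z ^ k)"
    have "f' sums suminf f'" and D: "((\<lambda>a. prabhakar a \<beta> \<gamma> z) has_field_derivative - suminf f') (at \<alpha>)"
      unfolding f'_def using prabhakar_deriv_alpha[OF assms(1)] summable_sums by blast+
    \<comment> \<open>The factor k kills the term at 0, so the series may start at k = 1 with the
      same sum.\<close>
    moreover have "f' 0 = 0"
      by (simp add: f'_def)
    ultimately have "(\<lambda>k. f' (Suc k)) sums suminf f'"
      using sums_Suc_iff[of f'] by simp
    with D show ?thesis
      unfolding f'_def by blast
  qed
  show "\<exists>S. (\<lambda>k. Digamma_over_Gamma (\<alpha> * of_nat k + \<beta>)
                  * pochhammer \<gamma> k / fact k * z ^ k) sums S
         \<and> ((\<lambda>b. prabhakar \<alpha> b \<gamma> z) has_field_derivative - S) (at \<beta>)"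
    using prabhakar_deriv_beta[OF assms(1)] summable_sums by blast
  \<comment> \<open>At \<gamma> = 0 the pole of \<psi> rules out the split, so the combined
    coefficient stays whole.\<close>
  show "\<exists>S. (\<lambda>k. pochhammer_Digamma_diff k \<gamma> / fact k
                    * rGamma (\<alpha> * of_nat k + \<beta>) * z ^ k) sums S
           \<and> ((\<lambda>c. prabhakar \<alpha> \<beta> c z) has_field_derivative S) (at \<gamma>)"
    using gamma(2,3) by blast
  show "\<exists>S T. (\<lambda>k. Digamma (\<gamma> + of_nat k) * pochhammer \<gamma> k / fact k
                      * rGamma (\<alpha> * of_nat k + \<beta>) * z ^ k) sums S
             \<and> (\<lambda>k. pochhammer \<gamma> k * z ^ k / fact k * rGamma (\<alpha> * of_nat k + \<beta>)) sums T
             \<and> ((\<lambda>c. prabhakar \<alpha> \<beta> c z) has_field_derivative S - Digamma \<gamma> * T) (at \<gamma>)"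
    if "\<gamma> \<noteq> 0"
  proof -
    define U where "U = (\<Sum>k. pochhammer_Digamma_diff k \<gamma> / fact k
                               * rGamma (\<alpha> * of_nat k + \<beta>) * z ^ k)"
    \<comment> \<open>Adding \<psi>(\<gamma>) times the defining series to the derivative series
      \<open>U\<close> turns the coefficient \<psi>(\<gamma> + k) - \<psi>(\<gamma>) into
      \<psi>(\<gamma> + k). This proves convergence of the first series, and subtracting
      \<psi>(\<gamma>) times the second recovers \<open>U\<close>.\<close>
    have "(\<lambda>k. pochhammer_Digamma_diff k \<gamma> / fact k * rGamma (\<alpha> * of_nat k + \<beta>) * z ^ k
             + Digamma \<gamma> * (pochhammer \<gamma> k * z ^ k / fact k * rGamma (\<alpha> * of_nat k + \<beta>)))
          sums (U + Digamma \<gamma> * prabhakar \<alpha> \<beta> \<gamma> z)"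
      unfolding U_def by (intro sums_add sums_mult conv gamma(2))
    also have "(\<lambda>k. pochhammer_Digamma_diff k \<gamma> / fact k * rGamma (\<alpha> * of_nat k + \<beta>) * z ^ k
             + Digamma \<gamma> * (pochhammer \<gamma> k * z ^ k / fact k * rGamma (\<alpha> * of_nat k + \<beta>))) =
        (\<lambda>k. Digamma (\<gamma> + of_nat k) * pochhammer \<gamma> k / fact k * rGamma (\<alpha> * of_nat k + \<beta>) * z ^ k)"
      by (simp add: pochhammer_Digamma_diff_eq_deriv deriv_pochhammer_nonpole[OF nonpole[OF that]]
          field_simps)
    finally show ?thesis
      using conv gamma(3) unfolding U_def
      by (intro exI[of _ "U + Digamma \<gamma> * prabhakar \<alpha> \<beta> \<gamma> z"] exI[of _ "prabhakar \<alpha> \<beta> \<gamma> z"])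
         (simp add: U_def)
  qed
qed

end
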